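(* Let $n\ge 2$ be an integer with prime factorization $n=p_1\cdots p_k$ (primes listed with multiplicity) such that $p_i\leq p_j$ whenever $i<j$. Let $m$ be the smallest index such that $p_m\geq 3$ (or $m=k$ if no such index exists), let $f_1$ be the number of indices $i\neq m$ with $p_i\leq 3$, and let $f_2$ be the number of indices $i\neq m$ with $p_i\geq 5$. Then \[\mathrm{rb}(\mathbb{Z}_n,S)=\mathrm{rb}(\mathbb{Z}_{p_m},S)+f_1+2f_2.\]
   Context: For a positive integer $n$, $\mathbb{Z}_n$ is the cyclic group of integers modulo $n$. An $r$-coloring of a set $X$ is a function $c:X\to\{1,\dots,r\}$; it is exact if $c$ is surjective. $S$ denotes the Sidon equation $x_1+x_2=x_3+x_4$. Given a coloring $c$ of $\mathbb{Z}_n$, a rainbow solution to $S$ is a quadruple $(x_1,x_2,x_3,x_4)\in\mathbb{Z}_n^4$ with $x_1+x_2=x_3+x_4$ such that the four colors $c(x_1),c(x_2),c(x_3),c(x_4)$ are pairwise distinct. The rainbow number $\mathrm{rb}(\mathbb{Z}_n,S)$ is the smallest positive integer $r$ such that every exact $r$-coloring of $\mathbb{Z}_n$ has a rainbow solution to $S$; by convention, if no $r\le n$ has this property, then $\mathrm{rb}(\mathbb{Z}_n,S)=n+1$ (so, e.g., $\mathrm{rb}(\mathbb{Z}_2,S)=3$ and $\mathrm{rb}(\mathbb{Z}_3,S)=4$). *)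

theory Defs
  imports "HOL-Algebra.Elementary_Groups" "HOL-Computational_Algebra.Primes"
begin

text \<open>
  The cyclic group of integers modulo \<open>n\<close> is \<open>integer_mod_group n\<close>, whose group operation,
  addition modulo \<open>n\<close>, is written multiplicatively. The values of a coloring
  \<open>c\<close> outside of the colored set are irrelevant.
\<close>

definition coloring :: "'a set \<Rightarrow> nat \<Rightarrow> ('a \<Rightarrow> nat) \<Rightarrow> bool" where
  "coloring X r c \<longleftrightarrow> c \<in> X \<rightarrow> {1..r}"

definition exact_coloring :: "'a set \<Rightarrow> nat \<Rightarrow> ('a \<Rightarrow> nat) \<Rightarrow> bool" where
  "exact_coloring X r c \<longleftrightarrow> coloring X r c \<and> c ` X = {1..r}"

definition sidon_solution :: "('a, 'b) monoid_scheme \<Rightarrow> 'a \<Rightarrow> 'a \<Rightarrow> 'a \<Rightarrow> 'a \<Rightarrow> bool" where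
  "sidon_solution G x1 x2 x3 x4 \<longleftrightarrow>
     x1 \<in> carrier G \<and> x2 \<in> carrier G \<and> x3 \<in> carrier G \<and> x4 \<in> carrier G \<and>
     x1 \<otimes>\<^bsub>G\<^esub> x2 = x3 \<otimes>\<^bsub>G\<^esub> x4"

definition has_rainbow_solution :: "('a, 'b) monoid_scheme \<Rightarrow> ('a \<Rightarrow> nat) \<Rightarrow> bool" where
  "has_rainbow_solution G c \<longleftrightarrow>
     (\<exists>x1 x2 x3 x4. sidon_solution G x1 x2 x3 x4 \<and> distinct [c x1, c x2, c x3, c x4])"

definition forces_rainbow :: "nat \<Rightarrow> nat \<Rightarrow> bool" where
  "forces_rainbow n r \<longleftrightarrow>
     (\<forall>c. exact_coloring (carrier (integer_mod_group n)) r c \<longrightarrow>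
          has_rainbow_solution (integer_mod_group n) c)"

text \<open>
  There is no exact \<open>r\<close>-coloring for \<open>r > n\<close>, so \<open>forces_rainbow n (n + 1)\<close> holds vacuously for
  \<open>n > 0\<close>; the second branch makes the resulting convention explicit.
\<close>

definition sidon_rb :: "nat \<Rightarrow> nat" where
  "sidon_rb n =
     (if \<exists>r\<in>{1..n}. forces_rainbow n r
      then LEAST r. 1 \<le> r \<and> forces_rainbow n r
      else n + 1)"

end

theory Submission
  imports Defs
begin

text \<open>
  Let \<open>F n\<close> be the largest number of colors of a rainbow-free coloring of \<open>\<int>\<^sub>n\<close>, so that the rainbow
  number is \<open>F n + 1\<close>. Then \<open>F n = 1 + (\<Sum>\<^sub>p w p) + [3 | n]\<close>, summed over the prime factors with
  multiplicity, where \<open>w p = 1\<close> for \<open>p \<le> 3\<close> and \<open>w p = 2\<close> for \<open>p \<ge> 5\<close>.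

  For the lower bound, color \<open>p\<int>\<^sub>p\<^sub>n \<cong> \<int>\<^sub>n\<close> with \<open>F n\<close> colors and its complement with \<open>w p\<close> new
  colors that are symmetric and constant on cosets; start from \<open>\<int>\<^sub>3\<close> if \<open>3 | n\<close>.

  For the upper bound, fix a step \<open>d\<close>. The two-element sets among \<open>{c x, c (x + d)}\<close> pairwise
  intersect, since \<open>x + (y + d) = y + (x + d)\<close>, so they form a star or lie in a triangle. With at
  least four colors, step 1 gives a star, centered at \<open>R\<close>, say. Let \<open>g\<close> be the least distance
  between two elements not colored \<open>R\<close>. Either these elements all lie in one coset of \<open>g\<int>\<close>, where
  \<open>g | n\<close>, or step \<open>g\<close> gives a star as well. In the second case \<open>x + u - v\<close> takes a longest run
  of step \<open>g\<close> to a run of at least that length, so the elements of all but two colors differ by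
  periods of a proper nonempty set and lie in one coset of some \<open>p\<int>\<close> with \<open>p | n\<close>. That coset
  misses at most \<open>w p\<close> colors, and one inducts on \<open>n\<close>.
\<close>

section \<open>Rainbow-free periodic colorings of the integers\<close>

definition rainbow_free :: "(int \<Rightarrow> nat) \<Rightarrow> bool" where
  "rainbow_free c \<longleftrightarrow> (\<forall>x y z t. x + y = z + t \<longrightarrow> \<not> distinct [c x, c y, c z, c t])"

text \<open>Colorings of \<open>integer_mod_group n\<close> are treated as \<open>n\<close>-periodic
  colorings of the integers with arbitrary color names, which avoids modular arithmetic;
  \<open>forces_rainbow_iff\<close> translates back.\<close>

definition periodic :: "nat \<Rightarrow> (int \<Rightarrow> 'a) \<Rightarrow> bool" where
  "periodic n c \<longleftrightarrow> (\<forall>x. c (x + int n) = c x)"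

definition star :: "(int \<Rightarrow> 'a) \<Rightarrow> int \<Rightarrow> 'a \<Rightarrow> bool" where
  "star c d C \<longleftrightarrow> (\<forall>x. c x \<noteq> c (x + d) \<longrightarrow> c x = C \<or> c (x + d) = C)"

lemma rainbow_freeD:
  assumes "rainbow_free c" "c x \<noteq> c y" "c x \<noteq> c z" "c y \<noteq> c z"
  shows "c (x + y - z) \<in> {c x, c y, c z}"
  using assms(1)[unfolded rainbow_free_def, rule_format, of x y z "x + y - z"] assms(2-4) by auto

lemma periodic_mult:
  assumes "periodic n c"
  shows "c (x + int n * k) = c x"
proof -
  have *: "c (x + int n * int j) = c x" for x j
  proof (induction j)
    case (Suc j)
    have "c (x + int n * int (Suc j)) = c ((x + int n * int j) + int n)" by (simp add: algebra_simps)
    also have "\<dots> = c x" using Suc assms unfolding periodic_def by metis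
    finally show ?case .
  qed simp
  show ?thesis
  proof (cases "k \<ge> 0")
    case True
    then show ?thesis using *[of x "nat k"] by simp
  next
    case False
    then show ?thesis using *[of "x + int n * k" "nat (-k)"] by (simp add: algebra_simps)
  qed
qed

lemma periodic_mod:
  assumes "periodic n c"
  shows "c (x mod int n) = c x"
  using periodic_mult[OF assms, of "x mod int n" "x div int n"] by simp

lemma periodic_range:
  assumes "periodic n c" "n > 0"
  shows "range c = c ` {0..<int n}"
proof -
  have "c x \<in> c ` {0..<int n}" for x
    using periodic_mod[OF assms(1), of x] assms(2)
    by (metis atLeastLessThan_iff image_eqI of_nat_0_less_iff pos_mod_bound pos_mod_sign)
  then show ?thesis by auto
qed

lemma finite_periodic_range:
  assumes "periodic n c" "n > 0"
  shows "finite (range c)"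
  using periodic_range[OF assms] by simp

lemma ex_color_notin:
  assumes "card (range c) > card S" "finite S"
  obtains x where "c x \<notin> S"
proof -
  have "\<not> range c \<subseteq> S" using assms card_mono leD by blast
  then show ?thesis using that by blast
qed

text \<open>Pairwise intersecting two-element sets without a common element all lie in one
  three-element set.\<close>

lemma star_or_triangle:
  assumes "rainbow_free c"
  obtains (star) C where "star c d C"
    | (triangle) S where "finite S" "card S \<le> 3"
        "\<And>x. c x \<noteq> c (x + d) \<Longrightarrow> c x \<in> S \<and> c (x + d) \<in> S"
proof -
  have meet: "{c x, c (x + d)} \<inter> {c y, c (y + d)} \<noteq> {}"
    if "c x \<noteq> c (x + d)" "c y \<noteq> c (y + d)" for x y
    using assms[unfolded rainbow_free_def, rule_format, of x "y + d" y "x + d"] that by auto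
  show ?thesis
  proof (cases "\<exists>C. star c d C")
    case False
    then obtain x where x: "c x \<noteq> c (x + d)" unfolding star_def by blast
    define a b where "a = c x" and "b = c (x + d)"
    \<comment> \<open>A pair avoiding \<open>a\<close> meets \<open>{a, b}\<close> in
      \<open>b\<close>, so it is \<open>{b, e}\<close>; a pair avoiding \<open>b\<close> must then
      be \<open>{a, e}\<close>.\<close>
    from False obtain y where y: "c y \<noteq> c (y + d)" "a \<noteq> c y" "a \<noteq> c (y + d)"
      unfolding star_def by metis
    then have "\<exists>e. {c y, c (y + d)} = {b, e}" using meet[OF x y(1)] unfolding a_def b_def by auto
    then obtain e where e: "{c y, c (y + d)} = {b, e}" by blast
    from False obtain z where z: "c z \<noteq> c (z + d)" "b \<noteq> c z" "b \<noteq> c (z + d)"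
      unfolding star_def by metis
    have "e \<in> {c z, c (z + d)}" using meet[OF y(1) z(1)] z(2,3) unfolding e by auto
    moreover have "a \<in> {c z, c (z + d)}"
      using meet[OF x z(1)] z(2,3) unfolding a_def b_def by auto
    moreover have "a \<noteq> e" using y(2,3) e by blast
    ultimately have ez: "{c z, c (z + d)} = {a, e}" by auto
    have "b \<noteq> e" using y(1) e by (metis doubleton_eq_iff insertCI singletonD)
    have "c w \<in> {a, b, e} \<and> c (w + d) \<in> {a, b, e}" if w: "c w \<noteq> c (w + d)" for w
      using meet[OF w x, folded a_def b_def] meet[OF w y(1), unfolded e] meet[OF w z(1), unfolded ez]
        x w \<open>a \<noteq> e\<close> \<open>b \<noteq> e\<close> by (auto simp: a_def b_def)
    moreover have "card {a, b, e} \<le> 3" by (simp add: card_insert_if)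
    ultimately show ?thesis using triangle[of "{a, b, e}"] by blast
  qed (use star in blast)
qed

section \<open>Monochromatic runs and periods\<close>

text \<open>Elements at distance \<open>d\<close> that both avoid the center have equal colors, so a
  progression avoiding \<open>C\<close> is monochromatic.\<close>

lemma star_run:
  assumes "star c d C" "\<And>i. i \<le> L \<Longrightarrow> c (z + int i * d) \<noteq> C" "i \<le> L"
  shows "c (z + int i * d) = c z"
  using assms(3)
proof (induction i)
  case (Suc i)
  have e: "z + int (Suc i) * d = (z + int i * d) + d" by (simp add: algebra_simps)
  have "c (z + int i * d) = c ((z + int i * d) + d)"
    using assms(1) assms(2)[of i] assms(2)[of "Suc i"] Suc.prems unfolding star_def e by auto
  then show ?case using Suc unfolding e by simp
qed simp

text \<open>The periods of \<open>S\<close> form a subgroup of the integers, generated by its least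
  positive element \<open>k\<close>. It contains \<open>n\<close> and is proper, so any prime factor
  of \<open>k\<close> serves.\<close>

lemma stabilizer_prime:
  fixes S :: "int set"
  assumes "S \<noteq> {}" "S \<noteq> UNIV" "n > 0" "\<And>x. x + int n \<in> S \<longleftrightarrow> x \<in> S"
  obtains p where "prime p" "p dvd n"
    "\<And>h. (\<And>x. x + h \<in> S \<longleftrightarrow> x \<in> S) \<Longrightarrow> int p dvd h"
proof -
  define St where "St h \<longleftrightarrow> (\<forall>x. x + h \<in> S \<longleftrightarrow> x \<in> S)" for h
  have add: "St (a + b)" if "St a" "St b" for a b
    using that unfolding St_def by (metis add.assoc)
  have neg: "St (-a)" if "St a" for a
    using that unfolding St_def by (metis add.assoc add.left_inverse add.right_neutral)
  have mult: "St (a * int j)" if "St a" for a j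
  proof (induction j)
    case (Suc j)
    then show ?case using add[OF that Suc] by (simp add: algebra_simps)
  qed (simp add: St_def)
  have mult: "St (a * j)" if "St a" for a j
  proof (cases "j \<ge> 0")
    case True
    then show ?thesis using mult[OF that, of "nat j"] by simp
  next
    case False
    then show ?thesis using neg[OF mult[OF that, of "nat (-j)"]] by simp
  qed
  define k where "k = (LEAST k. k > 0 \<and> St (int k))"
  have "n > 0 \<and> St (int n)" using assms by (simp add: St_def)
  then have k: "k > 0 \<and> St (int k)" unfolding k_def by (rule LeastI)
  have dvd: "int k dvd h" if "St h" for h
  proof -
    have "St (h + int k * (- (h div int k)))" using that mult k add by blast
    then have "St (int (nat (h mod int k)))" using k
      by (simp add: minus_mult_div_eq_mod)
    moreover have "nat (h mod int k) < k" using k by (simp add: nat_less_iff)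
    ultimately have "nat (h mod int k) = 0"
      using not_less_Least[of "nat (h mod int k)" "\<lambda>k. k > 0 \<and> St (int k)"] unfolding k_def by auto
    then have "h mod int k = 0" using k pos_mod_sign[of "int k" h] by linarith
    then show ?thesis by (simp add: dvd_eq_mod_eq_0)
  qed
  have "k \<noteq> 1"
  proof
    assume "k = 1"
    then have "St j" for j using mult[of 1 j] k by simp
    then have "x \<in> S \<longleftrightarrow> y \<in> S" for x y unfolding St_def by (metis add.commute diff_add_cancel)
    then show False using assms(1,2) by blast
  qed
  then obtain p where p: "prime p" "p dvd k" using prime_factor_nat by blast
  show ?thesis
  proof (rule that[OF p(1)])
    have "int k dvd int n" using dvd[of "int n"] assms(4) unfolding St_def by blast
    then show "p dvd n" using p(2) by (meson dvd_trans int_dvd_int_iff)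
    show "int p dvd h" if "\<And>x. x + h \<in> S \<longleftrightarrow> x \<in> S" for h
      using dvd[of h] that p(2) unfolding St_def by (meson dvd_trans int_dvd_int_iff)
  qed
qed

text \<open>By \<open>inv\<close>, differences of differently colored elements outside
  \<open>{C, X}\<close> are periods of \<open>S\<close>, since exchanging \<open>u\<close> and
  \<open>v\<close> gives the reverse shift.\<close>

lemma shift_invariant_prime:
  assumes "periodic n c" "n > 0" "card (range c) \<ge> 4"
    and "S \<noteq> {}" "S \<noteq> UNIV" "\<And>x. x + int n \<in> S \<longleftrightarrow> x \<in> S"
    and inv: "\<And>x u v. x \<in> S \<Longrightarrow> c u \<noteq> c v \<Longrightarrow> c u \<notin> {C, X} \<Longrightarrow> c v \<notin> {C, X} \<Longrightarrow> x + u - v \<in> S"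
  obtains p where "prime p" "p dvd n"
    "\<And>u v. c u \<notin> {C, X} \<Longrightarrow> c v \<notin> {C, X} \<Longrightarrow> int p dvd u - v"
proof -
  obtain p where p: "prime p" "p dvd n"
    "\<And>h. (\<And>x. x + h \<in> S \<longleftrightarrow> x \<in> S) \<Longrightarrow> int p dvd h"
    using stabilizer_prime[OF assms(4,5,2,6)] by blast
  have diff: "int p dvd u - v" if "c u \<noteq> c v" "c u \<notin> {C, X}" "c v \<notin> {C, X}" for u v
  proof (rule p(3))
    fix x
    show "x + (u - v) \<in> S \<longleftrightarrow> x \<in> S"
      using inv[of x u v] inv[of "x + (u - v)" v u] that by (auto simp: algebra_simps)
  qed
  have "int p dvd u - v" if uv: "c u \<notin> {C, X}" "c v \<notin> {C, X}" for u v
  proof (cases "c u = c v")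
    case True
    \<comment> \<open>For equal colors, the difference is split at an element \<open>w\<close> of
      another color outside \<open>{C, X}\<close>.\<close>
    have "card {C, X, c u} \<le> 3" by (simp add: card_insert_if)
    then obtain w where w: "c w \<notin> {C, X, c u}"
      using ex_color_notin[of "{C, X, c u}" c] assms(3) by auto
    have "int p dvd (u - w) + (w - v)"
      by (rule dvd_add) (use diff w uv True in auto)
    then show ?thesis by simp
  qed (use diff that in blast)
  then show ?thesis using that p by blast
qed

text \<open>The translate \<open>x + u - v\<close> avoids \<open>C\<close> if \<open>x\<close>,
  \<open>u\<close>, \<open>v\<close> have three distinct colors other than \<open>C\<close>, so runs
  go to runs. The invariant set consists of starts of infinite runs if some avoid \<open>C\<close>,
  and of starts of equal-colored pairs otherwise.\<close>

lemma run_lemma: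
  assumes rf: "rainbow_free c" and per: "periodic n c" "n > 0" and r: "card (range c) \<ge> 4"
    and star: "star c d C" and long: "c x0 = c (x0 + d)" "c x0 \<noteq> C"
    and full: "\<And>y. (\<And>i. c (y + int i * d) = c y) \<Longrightarrow> c y \<noteq> C \<Longrightarrow> c y = X0"
  obtains p X where "prime p" "p dvd n" "X \<noteq> C"
    "\<And>u v. c u \<notin> {C, X} \<Longrightarrow> c v \<notin> {C, X} \<Longrightarrow> int p dvd u - v"
proof (cases "\<exists>y. (\<forall>i. c (y + int i * d) = c y) \<and> c y \<noteq> C")
  case True
  then obtain y0 where y0: "\<And>i. c (y0 + int i * d) = c y0" "c y0 \<noteq> C" by blast
  then have X0: "c y0 = X0" using full by blast
  define S where "S = {y. \<forall>i. c (y + int i * d) = X0}"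
  have inv: "x + u - v \<in> S"
    if x: "x \<in> S" and uv: "c u \<noteq> c v" "c u \<notin> {C, X0}" "c v \<notin> {C, X0}" for x u v
  proof -
    have nC: "c ((x + u - v) + int i * d) \<noteq> C" for i
      using rainbow_freeD[OF rf, of "x + int i * d" u v] x uv y0 X0
      by (auto simp: S_def algebra_simps)
    have run: "c ((x + u - v) + int i * d) = c (x + u - v)" for i
      using star_run[OF star nC order_refl] .
    have "c (x + u - v) \<noteq> C" using nC[of 0] by simp
    then have "c (x + u - v) = X0" using full run by blast
    then show ?thesis using run by (simp add: S_def)
  qed
  have "y0 \<in> S" using y0 X0 by (simp add: S_def)
  moreover obtain w where "c w \<notin> {X0}" using ex_color_notin[of "{X0}" c] r by auto
  then have "w \<notin> S" unfolding S_def by (auto intro!: exI[of _ 0])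
  moreover have "x + int n \<in> S \<longleftrightarrow> x \<in> S" for x
  proof -
    have "c (x + int n + int i * d) = c (x + int i * d)" for i
      using per(1) unfolding periodic_def by (metis add.assoc add.commute)
    then show ?thesis by (simp add: S_def)
  qed
  ultimately obtain p where "prime p" "p dvd n"
    "\<And>u v. c u \<notin> {C, X0} \<Longrightarrow> c v \<notin> {C, X0} \<Longrightarrow> int p dvd u - v"
    using shift_invariant_prime[OF per r, of S C X0] inv by blast
  then show ?thesis using that y0(2) X0 by blast
next
  case False
  define X where "X = c x0"
  \<comment> \<open>Equal-colored pairs of two different colors would let runs grow without
    bound.\<close>
  have uniq: "c y = X" if y: "c y = c (y + d)" "c y \<noteq> C" for y
  proof (rule ccontr)
    assume "c y \<noteq> X"
    \<comment> \<open>adding a long pair of another color to a run yields a run longer by one\<close>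
    have "\<exists>z. \<forall>i\<le>L. c (z + int i * d) = c z \<and> c z \<noteq> C" for L
    proof (induction L)
      case 0
      show ?case using y(2) by auto
    next
      case (Suc L)
      then obtain z where z: "\<And>i. i \<le> L \<Longrightarrow> c (z + int i * d) = c z" "c z \<noteq> C" by blast
      \<comment> \<open>One of the pairs at \<open>x0\<close> and \<open>y\<close> differs in color
        from the current run.\<close>
      obtain w where w: "c w = c (w + d)" "c w \<noteq> C" "c w \<noteq> c z"
        using \<open>c y \<noteq> X\<close> y long unfolding X_def by metis
      have "card {C, c z, c w} \<le> 3" by (simp add: card_insert_if)
      then obtain q where q: "c q \<notin> {C, c z, c w}"
        using ex_color_notin[of "{C, c z, c w}" c] r by auto
      have nC: "c ((z + w - q) + int i * d) \<noteq> C" if "i \<le> Suc L" for i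
      proof (cases "i \<le> L")
        case True
        then show ?thesis using rainbow_freeD[OF rf, of "z + int i * d" w q] z w q
          by (auto simp: algebra_simps)
      next
        case False
        then have "i = Suc L" using that by simp
        then show ?thesis using rainbow_freeD[OF rf, of "z + int L * d" "w + d" q] z(1)[of L] z(2) w q
          by (auto simp: algebra_simps)
      qed
      have "c ((z + w - q) + int i * d) = c (z + w - q) \<and> c (z + w - q) \<noteq> C" if "i \<le> Suc L" for i
        using star_run[OF star, of "Suc L" "z + w - q" i] nC nC[of 0] that by auto
      then show ?case by blast
    qed
    then obtain z where z: "\<And>i. i \<le> n \<Longrightarrow> c (z + int i * d) = c z" "c z \<noteq> C" by blast
    \<comment> \<open>A run indexed from 0 to \<open>n\<close> wraps around the period and is
      therefore infinite, which this case excludes.\<close>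
    have "c (z + int i * d) = c z" for i
    proof -
      have "int i = int (i mod n) + int n * int (i div n)"
        by (metis mod_mult_div_eq of_nat_add of_nat_mult)
      then have "z + int i * d = (z + int (i mod n) * d) + int n * (int (i div n) * d)"
        by (simp add: algebra_simps)
      then have "c (z + int i * d) = c (z + int (i mod n) * d)" using periodic_mult[OF per(1)] by metis
      then show ?thesis using z(1)[of "i mod n"] per(2) by simp
    qed
    then show False using False z(2) by blast
  qed
  define S where "S = {y. c y = X \<and> c (y + d) = X}"
  have inv: "x + u - v \<in> S"
    if x: "x \<in> S" and uv: "c u \<noteq> c v" "c u \<notin> {C, X}" "c v \<notin> {C, X}" for x u v
  proof -
    have "c (x + u - v) \<noteq> C"
      using rainbow_freeD[OF rf, of x u v] x uv long(2) by (auto simp: S_def X_def)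
    moreover have "c ((x + u - v) + d) \<noteq> C"
      using rainbow_freeD[OF rf, of "x + d" u v] x uv long(2) by (auto simp: S_def X_def algebra_simps)
    ultimately have "c (x + u - v) = c ((x + u - v) + d)" using star unfolding star_def by blast
    then show ?thesis using uniq[of "x + u - v"] \<open>c (x + u - v) \<noteq> C\<close> by (simp add: S_def)
  qed
  have "x0 \<in> S" using long by (simp add: S_def X_def)
  moreover obtain w where "c w \<notin> {X}" using ex_color_notin[of "{X}" c] r by auto
  then have "w \<notin> S" unfolding S_def by auto
  moreover have "x + int n \<in> S \<longleftrightarrow> x \<in> S" for x
  proof -
    have "c (x + int n + d) = c (x + d)"
      using per(1) unfolding periodic_def by (metis add.assoc add.commute)
    then show ?thesis using per(1) by (simp add: S_def periodic_def)
  qed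
  ultimately obtain p where "prime p" "p dvd n"
    "\<And>u v. c u \<notin> {C, X} \<Longrightarrow> c v \<notin> {C, X} \<Longrightarrow> int p dvd u - v"
    using shift_invariant_prime[OF per r, of S C X] inv by blast
  then show ?thesis using that long(2) X_def by blast
qed

section \<open>All but two colors lie in a proper coset\<close>

text \<open>By periodicity the progression through \<open>t\<close> avoids \<open>R\<close> in both
  directions. An element off its coset comes less than \<open>g\<close> after one of its terms, so
  \<open>gap\<close> gives it the color \<open>R\<close>. Applied to \<open>t + n\<close>, this
  yields \<open>g dvd n\<close>.\<close>

lemma minimal_gap_coset:
  assumes per: "periodic n c" and "n > 0" "g > 0"
    and gap: "\<And>j t. 0 < j \<Longrightarrow> j < g \<Longrightarrow> c t \<noteq> R \<Longrightarrow> c (t + int j) = R"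
    and t: "\<And>i. c (t + int i * int g) \<noteq> R"
  shows "g dvd n" and "c s \<noteq> R \<Longrightarrow> int g dvd s - t"
proof -
  have t': "c (t + i * int g) \<noteq> R" for i
  proof -
    define q where "q = i div int n"
    define j where "j = nat (i mod int n)"
    have "i = int j + int n * q" using \<open>n > 0\<close> by (simp add: q_def j_def)
    then have "t + i * int g = (t + int j * int g) + int n * (q * int g)" by (simp add: algebra_simps)
    then show ?thesis using periodic_mult[OF per, of "t + int j * int g" "q * int g"] t[of j] by metis
  qed
  have dvd: "int g dvd s - t" if "c s \<noteq> R" for s
  proof (rule ccontr)
    assume n: "\<not> int g dvd s - t"
    define j where "j = nat ((s - t) mod int g)"
    have j1: "int j = (s - t) mod int g" using \<open>g > 0\<close> by (simp add: j_def)
    moreover have "(s - t) mod int g \<noteq> 0" using n by (simp add: dvd_eq_mod_eq_0)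
    moreover have "(s - t) mod int g < int g" using \<open>g > 0\<close> by simp
    ultimately have j: "0 < j" "j < g" by linarith+
    have "s = (t + (s - t) div int g * int g) + int j" using j1 by simp
    then show False using gap[OF j t'] that by metis
  qed
  show "c s \<noteq> R \<Longrightarrow> int g dvd s - t" by (rule dvd)
  have "c (t + int n) \<noteq> R" using t'[of 0] per unfolding periodic_def by simp
  then have "int g dvd int n" using dvd by fastforce
  then show "g dvd n" by simp
qed

lemma two_color_coset:
  assumes rf: "rainbow_free c" and per: "periodic n c" "n > 0" and r: "card (range c) \<ge> 4"
  obtains p R X where "prime p" "p dvd n" "star c 1 R"
    "\<And>u v. c u \<notin> {R, X} \<Longrightarrow> c v \<notin> {R, X} \<Longrightarrow> int p dvd u - v"
proof -
  \<comment> \<open>Steps of 1 from \<open>y\<close> reach \<open>z\<close> up to a multiple of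
    \<open>n\<close>, so the colors enter \<open>S\<close> on the way.\<close>
  have shift1: "\<exists>x. c x \<notin> S \<and> c (x + 1) \<in> S" if S: "c y \<notin> S" "c z \<in> S" for S y z
  proof (rule ccontr)
    assume *: "\<nexists>x. c x \<notin> S \<and> c (x + 1) \<in> S"
    have "c (y + int i) \<notin> S" for i
    proof (induction i)
      case (Suc i)
      then show ?case using * by (metis add.assoc of_nat_Suc add.commute)
    qed (use S in simp)
    from this[of "nat ((z - y) mod int n)"] have "c (y + (z - y) mod int n) \<notin> S"
      using per by simp
    moreover have "y + (z - y) mod int n = z + int n * (- ((z - y) div int n))"
      by (simp add: minus_mult_div_eq_mod[symmetric])
    ultimately show False using S periodic_mult[OF per(1)] by metis
  qed
  have pick: P if "card S \<le> 3" "finite S" "\<And>x. c x \<notin> S \<Longrightarrow> P" for S P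
  proof -
    have "card S < card (range c)" using that(1) r by linarith
    then show P using ex_color_notin that(2,3) by metis
  qed
  obtain R where R: "star c 1 R"
  proof (rule star_or_triangle[OF rf, of 1])
    \<comment> \<open>A color outside the triangle could never change under the shift by 1, so
      \<open>c\<close> would be constant.\<close>
    fix S assume S: "finite S" "card S \<le> 3" "\<And>x. c x \<noteq> c (x + 1) \<Longrightarrow> c x \<in> S \<and> c (x + 1) \<in> S"
    obtain y where y: "c y \<notin> S" using pick[OF S(2,1)] by blast
    obtain z where "c z \<noteq> c y" using pick[of "{c y}"] by auto
    then obtain x where "c x = c y" "c (x + 1) \<noteq> c y"
      using shift1[of y "- {c y}" z] by auto
    then show thesis using S(3)[of x] y by auto
  qed
  have "\<exists>x. c x = R"
  proof (rule ccontr)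
    assume "\<nexists>x. c x = R"
    then have *: "c x = c (x + 1)" for x using R unfolding star_def by blast
    obtain z where "c z \<noteq> c 0" using pick[of "{c 0}"] by auto
    then show False using shift1[of 0 "- {c 0}" z] * by auto
  qed
  then obtain r0 where r0: "c r0 = R" by blast
  define g where "g = (LEAST g. g > 0 \<and> (\<exists>t. c t \<noteq> R \<and> c (t + int g) \<noteq> R))"
  obtain t0 where t0: "c t0 \<noteq> R" using pick[of "{R}"] by auto
  \<comment> \<open>By periodicity \<open>n\<close> is such a distance, so the minimum
    exists.\<close>
  have "n > 0 \<and> (\<exists>t. c t \<noteq> R \<and> c (t + int n) \<noteq> R)"
    using per t0 unfolding periodic_def by auto
  then have "g > 0 \<and> (\<exists>t. c t \<noteq> R \<and> c (t + int g) \<noteq> R)" unfolding g_def by (rule LeastI)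
  then obtain t1 where g: "g > 0" and t1: "c t1 \<noteq> R" "c (t1 + int g) \<noteq> R" by blast
  have gap: "c (t + int j) = R" if "0 < j" "j < g" "c t \<noteq> R" for j t
    using not_less_Least[of j "\<lambda>g. g > 0 \<and> (\<exists>t. c t \<noteq> R \<and> c (t + int g) \<noteq> R)"] that
    unfolding g_def by blast
  show thesis
  proof (cases "\<exists>t. \<forall>i. c (t + int i * int g) \<noteq> R")
    case True
    then obtain t where t: "\<And>i. c (t + int i * int g) \<noteq> R" by blast
    note coset = minimal_gap_coset[OF per g gap t]
    \<comment> \<open>Otherwise the progression meets every residue modulo \<open>n\<close>,
      including that of \<open>r0\<close>.\<close>
    have "g \<noteq> 1"
    proof
      assume "g = 1"
      moreover have "int (nat ((r0 - t) mod int n)) = (r0 - t) mod int n" using per by simp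
      ultimately have "c (t + (r0 - t) mod int n) \<noteq> R"
        using t[of "nat ((r0 - t) mod int n)"] by simp
      moreover have "t + (r0 - t) mod int n = r0 + int n * (- ((r0 - t) div int n))"
        by (simp add: minus_mult_div_eq_mod[symmetric])
      ultimately show False using r0 periodic_mult[OF per(1)] by metis
    qed
    then obtain p where p: "prime p" "p dvd g" using prime_factor_nat by blast
    \<comment> \<open>All elements not colored \<open>R\<close> lie in one coset, so
      \<open>R\<close> itself can stand for \<open>X\<close>.\<close>
    show thesis
    proof (rule that[OF p(1) _ R])
      show "p dvd n" using p coset(1) by (meson dvd_trans)
      fix u v assume "c u \<notin> {R, R}" "c v \<notin> {R, R}"
      then have "int g dvd (u - t) - (v - t)" by (intro dvd_diff coset(2)) auto
      then have "int g dvd u - v" by simp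
      then show "int p dvd u - v" using p(2) by (meson dvd_trans int_dvd_int_iff)
    qed
  next
    case noT: False
    show thesis
    proof (cases "star c (int g) R")
      case True
      have long: "c t1 = c (t1 + int g)" using True t1 unfolding star_def by blast
      \<comment> \<open>Any such progression would avoid \<open>R\<close>, against
        \<open>noT\<close>.\<close>
      have full: "c y = R" if "\<And>i. c (y + int i * int g) = c y" "c y \<noteq> R" for y
      proof -
        have "\<forall>i. c (y + int i * int g) \<noteq> R" using that by simp
        then show ?thesis using noT by blast
      qed
      show thesis
      proof (rule run_lemma[OF rf per r True long t1(1) full])
        fix p X assume p: "prime p" "p dvd n"
          "\<And>u v. c u \<notin> {R, X} \<Longrightarrow> c v \<notin> {R, X} \<Longrightarrow> int p dvd u - v"
        show thesis by (rule that[OF p(1,2) R p(3)])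
      qed
    next
      case nstar: False
      obtain B where B: "star c (int g) B"
      proof (rule star_or_triangle[OF rf, of "int g"])
        fix S assume S: "finite S" "card S \<le> 3"
          "\<And>x. c x \<noteq> c (x + int g) \<Longrightarrow> c x \<in> S \<and> c (x + int g) \<in> S"
        \<comment> \<open>The shift by \<open>g\<close> preserves each color outside
          \<open>S\<close> and, if \<open>R\<close> is not in \<open>S\<close>, the property of not
          being colored \<open>R\<close>. Either way some full progression avoids
          \<open>R\<close>.\<close>
        have "\<exists>t. c t \<noteq> R \<and> (\<forall>x. (c x = c t \<or> R \<notin> S \<and> c x \<noteq> R) \<longrightarrow>
            (c (x + int g) = c t \<or> R \<notin> S \<and> c (x + int g) \<noteq> R))"
        proof (cases "R \<in> S")
          case True
          obtain t where "c t \<notin> S" using pick[OF S(2,1)] by blast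
          then show ?thesis using S(3) True by metis
        next
          case False
          then show ?thesis using S(3) t0 by metis
        qed
        then obtain t where t: "c t \<noteq> R"
          "\<And>x. (c x = c t \<or> R \<notin> S \<and> c x \<noteq> R) \<Longrightarrow>
            (c (x + int g) = c t \<or> R \<notin> S \<and> c (x + int g) \<noteq> R)" by blast
        have "c (t + int i * int g) = c t \<or> R \<notin> S \<and> c (t + int i * int g) \<noteq> R" for i
        proof (induction i)
          case (Suc i)
          show ?case using t(2)[OF Suc] by (simp add: algebra_simps)
        qed simp
        then have "\<forall>i. c (t + int i * int g) \<noteq> R" using t(1) by metis
        then show thesis using noT by blast
      qed
      have BR: "B \<noteq> R" using B nstar by blast
      have "g \<noteq> 1" using nstar R by auto
      then have nbr: "c (t + 1) = R" if "c t \<noteq> R" for t using gap[of 1 t] g that by simp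
      \<comment> \<open>As the center is now \<open>B\<close>, a pair colored \<open>R\<close> can
        serve as the long pair in \<open>run_lemma\<close>.\<close>
      have "\<exists>x. c x = R \<and> c (x + int g) = R"
      proof (rule ccontr)
        assume "\<nexists>x. c x = R \<and> c (x + int g) = R"
        \<comment> \<open>then shifting by \<open>g + 1\<close> permutes the elements not colored \<open>R\<close> and sends them all to \<open>B\<close>\<close>
        then have RB: "c (x + int g) = B" if "c x = R" for x
          using B BR that unfolding star_def by metis
        have TB: "c (t + (int g + 1)) = B" if "c t \<noteq> R" for t
          using RB[OF nbr[OF that]] by (simp add: algebra_simps)
        have it: "c (t + int i * (int g + 1)) \<noteq> R" if "c t \<noteq> R" for t i
        proof (induction i)
          case (Suc i)
          then show ?case using TB[OF Suc] BR by (simp add: algebra_simps)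
        qed (use that in simp)
        have "card {R, B} \<le> 3" by (simp add: card_insert_if)
        then obtain t where t: "c t \<notin> {R, B}" using pick[of "{R, B}"] by blast
        then have "c ((t + int (n - 1) * (int g + 1)) + (int g + 1)) = B" using TB it by auto
        moreover have "(t + int (n - 1) * (int g + 1)) + (int g + 1) = t + int n * (int g + 1)"
          using per(2) by (simp add: of_nat_diff algebra_simps)
        ultimately have "c (t + int n * (int g + 1)) = B" by metis
        then show False using t periodic_mult[OF per(1), of t "int g + 1"] by auto
      qed
      then obtain x0 where x0: "c x0 = c (x0 + int g)" "c x0 \<noteq> B" "c x0 = R" using BR by metis
      have full: "c y = R" if "\<And>i. c (y + int i * int g) = c y" "c y \<noteq> B" for y
      proof (rule ccontr)
        assume "c y \<noteq> R"
        then have "\<forall>i. c (y + int i * int g) \<noteq> R" using that by simp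
        then show False using noT by blast
      qed
      show thesis
      proof (rule run_lemma[OF rf per r B x0(1,2) full])
        fix p X assume p: "prime p" "p dvd n" "X \<noteq> B"
          "\<And>u v. c u \<notin> {B, X} \<Longrightarrow> c v \<notin> {B, X} \<Longrightarrow> int p dvd u - v"
        \<comment> \<open>Otherwise an element outside \<open>{R, B, X}\<close> and its successor,
          colored \<open>R\<close>, both avoid \<open>{B, X}\<close>, so \<open>p\<close> would
          divide 1.\<close>
        have "X = R"
        proof (rule ccontr)
          assume "X \<noteq> R"
          have "card {R, B, X} \<le> 3" by (simp add: card_insert_if)
          then obtain t where "c t \<notin> {R, B, X}" using pick[of "{R, B, X}"] by blast
          then have "int p dvd (t + 1) - t" using nbr[of t] BR \<open>X \<noteq> R\<close> by (intro p(4)) auto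
          then show False using p(1) by simp
        qed
        then show thesis using that[OF p(1,2) R, of B] p(4) by (simp add: insert_commute)
      qed
    qed
  qed
qed

section \<open>The maximal number of colors\<close>

text \<open>The nonzero residues modulo a prime \<open>p\<close> form a single class up to sign
  exactly if \<open>p \<le> 3\<close>. For larger \<open>p\<close> there is room for two new
  colors.\<close>

definition weight :: "nat \<Rightarrow> nat" where
  "weight p = (if p \<le> 3 then 1 else 2)"

text \<open>Three colors are never rainbow, so \<open>n = 3\<close> allows three colors instead of
  \<open>1 + weight 3 = 2\<close>. The last summand is this extra color, counted once even if 9
  divides \<open>n\<close>.\<close>

definition max_colors :: "nat \<Rightarrow> nat" where
  "max_colors n = 1 + (\<Sum>p\<in>#prime_factorization n. weight p) + (if 3 dvd n then 1 else 0)"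

lemma three_dvd_prime: "prime (p::nat) \<Longrightarrow> 3 dvd p \<longleftrightarrow> p = 3"
  using primes_dvd_imp_eq[of 3 p] by auto

lemma max_colors_mult:
  assumes "prime p" "n > 0"
  shows "max_colors (p * n) = max_colors n + weight p + (if p = 3 \<and> \<not> 3 dvd n then 1 else 0)"
proof -
  have "3 dvd p * n \<longleftrightarrow> p = 3 \<or> 3 dvd n"
    using three_dvd_prime[OF assms(1)] by (simp add: prime_dvd_mult_iff)
  moreover have "prime_factorization (p * n) = {#p#} + prime_factorization n"
    using assms by (simp add: prime_factorization_mult prime_factorization_prime)
  ultimately show ?thesis by (auto simp: max_colors_def)
qed

lemma max_colors_1: "max_colors (Suc 0) = 1"
  by (simp add: max_colors_def)

lemma max_colors_prime: "prime p \<Longrightarrow> max_colors p = 1 + weight p + (if p = 3 then 1 else 0)"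
  using max_colors_mult[of p 1] by (simp add: max_colors_1)

text \<open>This settles colorings with at most three colors, to which the coset argument does not
  apply.\<close>

lemma max_colors_ge_3:
  assumes "n \<ge> 3"
  shows "max_colors n \<ge> 3"
proof -
  obtain p m where p: "prime p" "n = p * m" using prime_factor_nat[of n] assms by (auto elim: dvdE)
  then have "m > 0" using assms by (cases m) auto
  show ?thesis
  proof (cases "m = 1")
    case True
    then show ?thesis using assms p max_colors_prime[of p] by (auto simp: weight_def)
  next
    case False
    then obtain q l where q: "prime q" "m = q * l" using prime_factor_nat[of m] by (auto elim: dvdE)
    then have "l > 0" using \<open>m > 0\<close> by (cases l) auto
    have "weight p \<ge> 1" "weight q \<ge> 1" "max_colors l \<ge> 1"
      by (auto simp: weight_def max_colors_def)
    then show ?thesis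
      using max_colors_mult[OF p(1) \<open>m > 0\<close>] max_colors_mult[OF q(1) \<open>l > 0\<close>] p(2) q(2) by simp
  qed
qed

text \<open>Every color except \<open>R\<close> and \<open>X\<close> appears on the coset of
  \<open>u\<close>, so at most two are missing. If \<open>p \<le> 3\<close>, every integer is within
  distance 1 of the coset, and the star at step 1 prevents both from being missing.\<close>

lemma coset_missing_colors:
  assumes rf: "rainbow_free c" and per: "periodic n c" "n > 0" and r: "card (range c) \<ge> 4"
  obtains p u where "prime p" "p dvd n"
    "card (range c) \<le> card (range (\<lambda>x. c (u + int p * x))) + weight p"
proof -
  obtain p R X where p: "prime p" "p dvd n" and R: "star c 1 R"
    and RX: "\<And>u v. c u \<notin> {R, X} \<Longrightarrow> c v \<notin> {R, X} \<Longrightarrow> int p dvd u - v"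
    using two_color_coset[OF rf per r] by blast
  have fin: "finite (range c)" using finite_periodic_range[OF per] .
  have "card {R, X} \<le> 2" by (simp add: card_insert_if)
  then have "card {R, X} < card (range c)" using r by linarith
  then obtain u where u: "c u \<notin> {R, X}" using ex_color_notin[of "{R, X}" c] by blast
  define K where "K = range (\<lambda>x. c (u + int p * x))"
  have K: "c v \<in> K" if "int p dvd v - u" for v
  proof -
    obtain k where "v - u = int p * k" using \<open>int p dvd v - u\<close> unfolding dvd_def by blast
    then have "v = u + int p * k" by simp
    then show ?thesis unfolding K_def by blast
  qed
  have miss: "range c - K \<subseteq> {R, X}" using K RX u by blast
  have "card (range c - K) \<le> weight p"
  proof (cases "p \<le> 3")
    case False
    have "card (range c - K) \<le> card {R, X}" using miss by (intro card_mono) auto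
    then show ?thesis using False \<open>card {R, X} \<le> 2\<close> by (simp add: weight_def)
  next
    case True
    have "range c - K \<subseteq> {R} \<or> range c - K \<subseteq> {X}"
    proof (rule ccontr)
      assume "\<not> ?thesis"
      \<comment> \<open>a point colored \<open>X\<close> would be next to the coset, although every edge of step 1 meets \<open>R\<close>\<close>
      then have nK: "X \<in> range c" "X \<noteq> R" "X \<notin> K" "R \<notin> K" using miss by auto
      then obtain z where z: "c z = X" by blast
      have K': "c v \<notin> {R, X}" if "int p dvd v - u" for v using K[OF that] nK by auto
      have "p = 2 \<or> p = 3" using True prime_gt_1_nat[OF p(1)] by linarith
      \<comment> \<open>Each residue modulo 2 or 3 is 0, 1 or -1.\<close>
      then have "int p dvd z - u \<or> int p dvd (z - 1) - u \<or> int p dvd (z + 1) - u" by presburger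
      then consider "int p dvd z - u" | "int p dvd (z - 1) - u" | "int p dvd (z + 1) - u" by blast
      then show False
      proof cases
        case 1
        then show False using K'[of z] z by simp
      next
        case 2
        then show False using K'[of "z - 1"] z nK R[unfolded star_def, rule_format, of "z - 1"] by auto
      next
        case 3
        then show False using K'[of "z + 1"] z nK R[unfolded star_def, rule_format, of z] by auto
      qed
    qed
    then have "card (range c - K) \<le> 1" by (metis One_nat_def card_mono card.empty card_insert_disjoint finite.emptyI finite.insertI empty_iff)
    then show ?thesis using True by (simp add: weight_def)
  qed
  moreover have "card (range c) = card K + card (range c - K)"
  proof -
    have "K \<subseteq> range c" by (auto simp: K_def)
    then show ?thesis using fin by (metis card_Diff_subset card_mono finite_subset le_add_diff_inverse)
  qed
  ultimately show ?thesis using that[OF p, of u] by (simp add: K_def)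
qed

text \<open>Rescaling the coset of \<open>coset_missing_colors\<close> gives a rainbow-free coloring
  of period \<open>n\<close> divided by \<open>p\<close>, which loses at most
  \<open>weight p\<close> colors.\<close>

lemma card_range_le_max_colors:
  assumes "rainbow_free c" "periodic n c" "n > 0"
  shows "card (range c) \<le> max_colors n"
  using assms
proof (induction n arbitrary: c rule: less_induct)
  case (less n)
  show ?case
  proof (cases "card (range c) \<ge> 4")
    case True
    obtain p u where p: "prime p" "p dvd n"
      "card (range c) \<le> card (range (\<lambda>x. c (u + int p * x))) + weight p"
      using coset_missing_colors[OF less.prems True] by blast
    obtain m where m: "n = p * m" using p(2) by (elim dvdE)
    have m0: "m > 0" "m < n" using m less.prems(3) prime_gt_1_nat[OF p(1)] by auto
    have "card (range (\<lambda>x. c (u + int p * x))) \<le> max_colors m"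
    proof (rule less.IH[OF m0(2) _ _ m0(1)])
      show "rainbow_free (\<lambda>x. c (u + int p * x))" unfolding rainbow_free_def
      proof (intro allI impI)
        fix x y z t :: int assume "x + y = z + t"
        then have "int p * (x + y) = int p * (z + t)" by simp
        then have "(u + int p * x) + (u + int p * y) = (u + int p * z) + (u + int p * t)"
          by (simp add: algebra_simps)
        then show "\<not> distinct [c (u + int p * x), c (u + int p * y), c (u + int p * z), c (u + int p * t)]"
          using less.prems(1) unfolding rainbow_free_def by blast
      qed
      show "periodic m (\<lambda>x. c (u + int p * x))" unfolding periodic_def
      proof
        fix x
        have "u + int p * (x + int m) = (u + int p * x) + int n" by (simp add: m algebra_simps)
        then show "c (u + int p * (x + int m)) = c (u + int p * x)"
          using less.prems(2) unfolding periodic_def by metis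
      qed
    qed
    then show ?thesis using p(3) max_colors_mult[OF p(1) m0(1)] m by simp
  next
    case False
    have n: "card (range c) \<le> n"
      using periodic_range[OF less.prems(2,3)] card_image_le[of "{0..<int n}" c] by simp
    consider "n \<ge> 3" | "n = 2" | "n = 1" using less.prems(3) by linarith
    then show ?thesis
    proof cases
      case 1
      then show ?thesis using max_colors_ge_3[of n] False by simp
    next
      case 2
      then show ?thesis using n max_colors_prime[of 2] by (simp add: weight_def)
    next
      case 3
      then show ?thesis using n by (simp add: max_colors_def)
    qed
  qed
qed

section \<open>Construction of optimal colorings\<close>

text \<open>In a solution with terms off the multiples of \<open>p\<close>, two such terms share a
  color: three by pigeonhole, two because they are congruent or opposite modulo \<open>p\<close>. A
  single one is impossible modulo \<open>p\<close>.\<close>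

lemma extend_coloring:
  assumes p: "prime p" and rf: "rainbow_free c" and per: "periodic n c" "n > 0"
  obtains c' where "rainbow_free c'" "periodic (p * n) c'"
    "card (range c') = card (range c) + weight p"
proof -
  define col :: "int \<Rightarrow> nat" where "col x = (if int p dvd x - 1 \<or> int p dvd x + 1 then 0 else 1)" for x
  \<comment> \<open>Adding 2 keeps the old colors apart from the values 0 and 1 of
    \<open>col\<close>.\<close>
  define c' where "c' x = (if int p dvd x then c (x div int p) + 2 else col x)" for x
  have p1: "int p > 1" using prime_gt_1_nat[OF p] by simp
  have col_diff: "col x = col y" if "int p dvd x - y" for x y
  proof -
    have "int p dvd x - 1 \<longleftrightarrow> int p dvd y - 1" "int p dvd x + 1 \<longleftrightarrow> int p dvd y + 1"
      using dvd_add_right_iff[OF that, of "y - 1"] dvd_add_right_iff[OF that, of "y + 1"] by simp_all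
    then show ?thesis by (simp add: col_def)
  qed
  have col_minus: "col (- x) = col x" for x
  proof -
    have "int p dvd - x - 1 \<longleftrightarrow> int p dvd x + 1" "int p dvd - x + 1 \<longleftrightarrow> int p dvd x - 1"
      using dvd_minus_iff[of "int p" "x + 1"] dvd_minus_iff[of "int p" "x - 1"] by simp_all
    then show ?thesis by (auto simp: col_def)
  qed
  have col_sum: "col x = col y" if "int p dvd x + y" for x y
    using col_diff[of x "- y"] col_minus[of y] that by simp
  have col2: "col x \<le> 1" for x by (simp add: col_def)
  show thesis
  proof (rule that)
    show "rainbow_free c'" unfolding rainbow_free_def
    proof (intro allI impI notI)
      fix x y z t :: int
      assume eq: "x + y = z + t" and d: "distinct [c' x, c' y, c' z, c' t]"
      let ?P = "\<lambda>x. int p dvd x"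
      have two: "c' a = c' b \<or> c' b = c' e \<or> c' a = c' e" if "\<not> ?P a" "\<not> ?P b" "\<not> ?P e" for a b e
        using that col2[of a] col2[of b] col2[of e] by (auto simp: c'_def)
      have diff: "c' a = c' b" if "\<not> ?P a" "\<not> ?P b" "?P (a - b)" for a b
        using that col_diff by (simp add: c'_def)
      have sum: "c' a = c' b" if "\<not> ?P a" "\<not> ?P b" "?P (a + b)" for a b
        using that col_sum by (simp add: c'_def)
      have "?P x \<and> ?P y \<and> ?P z \<and> ?P t"
      proof (rule ccontr)
        assume n: "\<not> ?thesis"
        have e: "x + y = z + t" "x - z = t - y" "x - t = z - y" using eq by auto
        have ed: "?P (x + y) \<longleftrightarrow> ?P (z + t)" "?P (x - z) \<longleftrightarrow> ?P (t - y)" "?P (x - t) \<longleftrightarrow> ?P (z - y)"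
          by (simp_all only: e)
        have dd: "?P (z - y) \<longleftrightarrow> ?P (y - z)" "?P (t - y) \<longleftrightarrow> ?P (y - t)"
          by (simp_all add: dvd_diff_commute)
        have add: "(?P a \<longrightarrow> ?P (a + b) = ?P b) \<and> (?P b \<longrightarrow> ?P (a + b) = ?P a)" for a b
          by (simp_all add: dvd_add_right_iff dvd_add_left_iff)
        have minus: "(?P a \<longrightarrow> ?P (a - b) = ?P b) \<and> (?P b \<longrightarrow> ?P (a - b) = ?P a)" for a b
          by (simp add: dvd_diff_right_iff dvd_diff_left_iff)
        have "c' x \<noteq> c' y" "c' x \<noteq> c' z" "c' x \<noteq> c' t" "c' y \<noteq> c' z" "c' y \<noteq> c' t" "c' z \<noteq> c' t"
          using d by auto
        then show False
          using n ed dd two[of x y z] two[of x y t] two[of x z t] two[of y z t]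
            sum[of x y] sum[of z t] diff[of x z] diff[of x t] diff[of y z] diff[of y t]
            add[of x y] add[of z t] minus[of x z] minus[of x t] minus[of y z] minus[of y t]
          by satx
      qed
      then obtain x' y' z' t' where "x = int p * x'" "y = int p * y'" "z = int p * z'" "t = int p * t'"
        by (elim conjE dvdE)
      moreover from this have "int p * (x' + y') = int p * (z' + t')" using eq by (simp add: distrib_left)
      then have "x' + y' = z' + t'" using p1 by simp
      ultimately show False using d rf[unfolded rainbow_free_def, rule_format, of x' y' z' t'] p1
        by (auto simp: c'_def)
    qed
    show "periodic (p * n) c'" unfolding periodic_def
    proof
      fix x
      have "int p dvd x + int (p * n) \<longleftrightarrow> int p dvd x" by (simp add: dvd_add_left_iff)
      moreover have "(x + int (p * n)) div int p = x div int p + int n" using p1 by simp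
      moreover have "col (x + int (p * n)) = col x" by (rule col_diff) simp
      ultimately show "c' (x + int (p * n)) = c' x" using per(1) by (simp add: c'_def periodic_def)
    qed
    \<comment> \<open>These are the colors used off the multiples of \<open>p\<close>. Color 1
      occurs exactly if \<open>p > 3\<close>, for instance at 2, which is then not 0, 1 or -1 modulo
      \<open>p\<close>.\<close>
    define N where "N = (if p \<le> 3 then {0} else {0::nat, 1})"
    have "range c' = (\<lambda>k. k + 2) ` range c \<union> N"
    proof (intro equalityI subsetI)
      fix k assume "k \<in> range c'"
      then obtain x where x: "k = c' x" by blast
      have "k \<in> N" if "\<not> int p dvd x"
      proof (cases "p \<le> 3")
        case True
        then have "p = 2 \<or> p = 3" using p1 by linarith
        then have "int p dvd x - 1 \<or> int p dvd x + 1" using that by presburger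
        then show ?thesis using x that by (simp add: c'_def col_def N_def)
      next
        case False
        then show ?thesis using x that by (auto simp: c'_def col_def N_def)
      qed
      then show "k \<in> (\<lambda>k. k + 2) ` range c \<union> N" using x by (cases "int p dvd x") (auto simp: c'_def)
    next
      fix k assume "k \<in> (\<lambda>k. k + 2) ` range c \<union> N"
      then consider (1) x where "k = c x + 2" | (2) "k = 0" | (3) "k = 1" "p > 3"
        by (auto simp: N_def split: if_splits)
      then show "k \<in> range c'"
      proof cases
        case 1
        then have "k = c' (int p * x)" using p1 by (simp add: c'_def)
        then show ?thesis by blast
      next
        case 2
        have "\<not> int p dvd 1" using p1 by simp
        then have "k = c' 1" using 2 by (simp add: c'_def col_def)
        then show ?thesis by blast
      next
        case 3
        have "\<not> int p dvd 1" "\<not> int p dvd 2" "\<not> int p dvd 3" using 3(2) by (auto dest: zdvd_imp_le)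
        then have "k = c' 2" using 3 by (simp add: c'_def col_def)
        then show ?thesis by blast
      qed
    qed
    moreover have "card ((\<lambda>k. k + 2) ` range c \<union> N) = card (range c) + weight p"
    proof -
      have "card ((\<lambda>k. k + 2) ` range c \<union> N) = card ((\<lambda>k. k + 2) ` range c) + card N"
        using finite_periodic_range[OF per] by (intro card_Un_disjoint) (auto simp: N_def)
      then show ?thesis by (simp add: card_image inj_on_def N_def weight_def)
    qed
    ultimately show "card (range c') = card (range c) + weight p" by simp
  qed
qed

text \<open>If 3 divides \<open>n\<close>, the construction starts from three colors at 3, and one
  factor 3 is kept to the end. Thus each extension step adds exactly \<open>weight p\<close> to
  \<open>max_colors\<close>.\<close>

lemma max_colors_attained:
  assumes "n > 0"
  shows "\<exists>c. rainbow_free c \<and> periodic n c \<and> card (range c) = max_colors n"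
  using assms
proof (induction n rule: less_induct)
  case (less n)
  have step: ?case
    if p: "prime p" "n = p * m" "p = 3 \<longrightarrow> 3 dvd m" for p m
  proof -
    have m: "m > 0" "m < n" using p less.prems prime_gt_1_nat[OF p(1)] by auto
    obtain c where c: "rainbow_free c" "periodic m c" "card (range c) = max_colors m"
      using less.IH[OF m(2,1)] by blast
    obtain c' where "rainbow_free c'" "periodic (p * m) c'" "card (range c') = card (range c) + weight p"
      using extend_coloring[OF p(1) c(1,2) m(1)] by blast
    then show ?thesis using p max_colors_mult[OF p(1) m(1)] c(3) by auto
  qed
  consider "n = 1" | "n = 3" | (not3) "n \<noteq> 1" "\<not> 3 dvd n" | (three) "n \<noteq> 3" "3 dvd n" by blast
  then show ?case
  proof cases
    case 1
    have "rainbow_free (\<lambda>_. 0)" "periodic n (\<lambda>_. 0 :: nat)" "card (range (\<lambda>_::int. 0::nat)) = max_colors n"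
      using 1 by (auto simp: rainbow_free_def periodic_def max_colors_def)
    then show ?thesis by blast
  next
    case 2
    define c where "c x = nat (x mod 3)" for x :: int
    have "range c = {0, 1, 2}"
    proof -
      have "periodic 3 c" by (auto simp: periodic_def c_def)
      then have "range c = c ` {0..<3}" using periodic_range[of 3 c] by simp
      also have "{0..<3::int} = {0, 1, 2}" by auto
      finally show ?thesis by (simp add: c_def)
    qed
    moreover have "rainbow_free c" unfolding rainbow_free_def
    proof (intro allI impI)
      fix x y z t
      have "c v \<in> {0, 1, 2}" for v using \<open>range c = {0, 1, 2}\<close> by blast
      from this[of x] this[of y] this[of z] this[of t]
      show "\<not> distinct [c x, c y, c z, c t]" by auto
    qed
    moreover have "periodic n c" using 2 by (auto simp: periodic_def c_def)
    ultimately show ?thesis using 2 max_colors_prime[of 3] by (intro exI[of _ c]) (simp add: weight_def)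
  next
    case not3
    obtain p where p: "prime p" "p dvd n" using prime_factor_nat not3(1) by blast
    then obtain m where "n = p * m" by (elim dvdE)
    then show ?thesis using step[OF p(1)] not3(2) p(2) by blast
  next
    case three
    then obtain l where l: "n = 3 * l" by (elim dvdE)
    then have "l \<noteq> 1" using three(1) by auto
    then obtain p where p: "prime p" "p dvd l" using prime_factor_nat by blast
    then obtain m where m: "l = p * m" by (elim dvdE)
    then show ?thesis using step[OF p(1), of "3 * m"] l by simp
  qed
qed

section \<open>The rainbow number\<close>

lemma rainbow_free_comp: "rainbow_free c \<Longrightarrow> rainbow_free (f \<circ> c)"
  unfolding rainbow_free_def by (auto, metis)

text \<open>Colors are renamed by a bijection with \<open>{1..r}\<close> in one direction; in the
  other, a coloring of residues is composed with reduction modulo \<open>n\<close>.\<close>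

lemma forces_rainbow_iff:
  assumes "n > 0"
  shows "forces_rainbow n r \<longleftrightarrow> \<not> (\<exists>c. rainbow_free c \<and> periodic n c \<and> card (range c) = r)"
proof
  assume f: "forces_rainbow n r"
  show "\<not> (\<exists>c. rainbow_free c \<and> periodic n c \<and> card (range c) = r)"
  proof
    assume "\<exists>c. rainbow_free c \<and> periodic n c \<and> card (range c) = r"
    then obtain c where c: "rainbow_free c" "periodic n c" "card (range c) = r" by blast
    have "finite (range c)" using finite_periodic_range[OF c(2) assms] .
    then obtain h where "bij_betw h {1..r} (range c)" using ex_bij_betw_nat_finite_1 c(3) by blast
    then have h: "bij_betw (inv_into {1..r} h) (range c) {1..r}" by (rule bij_betw_inv_into)
    define c' where "c' = inv_into {1..r} h \<circ> c"
    have "c' ` {0..<int n} = {1..r}"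
      using h periodic_range[OF c(2) assms] unfolding c'_def by (metis bij_betw_def image_comp)
    then have "exact_coloring (carrier (integer_mod_group n)) r c'"
      using assms by (auto simp: exact_coloring_def coloring_def carrier_integer_mod_group)
    then have "has_rainbow_solution (integer_mod_group n) c'" using f by (simp add: forces_rainbow_def)
    then obtain x y z t where s: "(x + y) mod int n = (z + t) mod int n" "distinct [c' x, c' y, c' z, c' t]"
      by (auto simp: has_rainbow_solution_def sidon_solution_def)
    \<comment> \<open>A solution modulo \<open>n\<close> becomes a solution over the integers when
      \<open>t\<close> is replaced by a congruent number.\<close>
    have "(x + y - z) mod int n = t mod int n"
      using mod_diff_cong[OF s(1) refl, of z] by simp
    then have "c (x + y - z) = c t" using periodic_mod[OF c(2)] by metis
    then have "\<not> distinct [c x, c y, c z, c t]"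
      using c(1)[unfolded rainbow_free_def, rule_format, of x y z "x + y - z"] by auto
    then show False using s(2) by (auto simp: c'_def)
  qed
next
  assume *: "\<not> (\<exists>c. rainbow_free c \<and> periodic n c \<and> card (range c) = r)"
  show "forces_rainbow n r" unfolding forces_rainbow_def
  proof (intro allI impI, rule ccontr)
    fix c assume c: "exact_coloring (carrier (integer_mod_group n)) r c"
      and nr: "\<not> has_rainbow_solution (integer_mod_group n) c"
    define c' where "c' x = c (x mod int n)" for x
    have per: "periodic n c'" by (simp add: c'_def periodic_def)
    have "c' ` {0..<int n} = c ` {0..<int n}" by (auto simp: c'_def)
    then have "range c' = {1..r}"
      using c assms periodic_range[OF per assms]
      by (simp add: exact_coloring_def carrier_integer_mod_group)
    then have "card (range c') = r" by simp
    moreover have "rainbow_free c'" unfolding rainbow_free_def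
    proof (intro allI impI notI)
      fix x y z t assume "x + y = z + t" and d: "distinct [c' x, c' y, c' z, c' t]"
      then have "sidon_solution (integer_mod_group n) (x mod int n) (y mod int n) (z mod int n) (t mod int n)"
        using assms by (simp add: sidon_solution_def carrier_integer_mod_group mod_add_eq)
      then show False using nr d unfolding has_rainbow_solution_def c'_def by blast
    qed
    ultimately show False using per * by blast
  qed
qed

text \<open>Merging all colors from \<open>r\<close> on into one creates no rainbow
  solution.\<close>

lemma fewer_colors:
  assumes "rainbow_free c" "periodic n c" "n > 0" "r \<ge> 1" "r \<le> card (range c)"
  shows "\<exists>c'. rainbow_free c' \<and> periodic n c' \<and> card (range c') = r"
proof -
  have "finite (range c)" using finite_periodic_range[OF assms(2,3)] .
  then obtain h where "bij_betw h {1..card (range c)} (range c)" using ex_bij_betw_nat_finite_1 by blast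
  then have h: "bij_betw (inv_into {1..card (range c)} h) (range c) {1..card (range c)}"
    by (rule bij_betw_inv_into)
  define c' where "c' = (min r \<circ> inv_into {1..card (range c)} h) \<circ> c"
  have "range c' = min r ` {1..card (range c)}"
    using h unfolding c'_def bij_betw_def by (metis image_comp)
  also have "\<dots> = {1..r}"
  proof (intro equalityI subsetI)
    fix k assume "k \<in> {1..r}"
    then show "k \<in> min r ` {1..card (range c)}" using assms(5) by (intro image_eqI[of _ _ k]) auto
  qed (use assms(4) in auto)
  finally have "card (range c') = r" by simp
  moreover have "rainbow_free c'" unfolding c'_def using assms(1) by (rule rainbow_free_comp)
  moreover have "periodic n c'" using assms(2) by (simp add: c'_def periodic_def)
  ultimately show ?thesis by blast
qed

lemma sidon_rb_eq:
  assumes "n > 0"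
  shows "sidon_rb n = max_colors n + 1"
proof -
  obtain c where c: "rainbow_free c" "periodic n c" "card (range c) = max_colors n"
    using max_colors_attained[OF assms] by blast
  have low: "\<not> forces_rainbow n r" if "1 \<le> r" "r \<le> max_colors n" for r
    using fewer_colors[OF c(1,2) assms that(1)] that(2) c(3) forces_rainbow_iff[OF assms] by auto
  have up: "forces_rainbow n (max_colors n + 1)"
    using card_range_le_max_colors[of _ n] assms forces_rainbow_iff[OF assms]
    by (metis Suc_eq_plus1 not_less_eq_eq order_refl)
  have least: "(LEAST r. 1 \<le> r \<and> forces_rainbow n r) = max_colors n + 1"
    using up low by (intro Least_equality) (auto simp: not_less_eq_eq[symmetric])
  show ?thesis
  proof (cases "max_colors n + 1 \<le> n")
    case True
    then have "\<exists>r\<in>{1..n}. forces_rainbow n r" using up by force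
    then show ?thesis using least by (simp add: sidon_rb_def)
  next
    case False
    \<comment> \<open>In this case all \<open>n\<close> elements can have distinct colors, and the
      convention \<open>n + 1\<close> agrees with the formula.\<close>
    have "max_colors n \<le> n"
      using periodic_range[OF c(2) assms] card_image_le[of "{0..<int n}" c] c(3) by simp
    then have "max_colors n = n" using False by simp
    then have "\<not> (\<exists>r\<in>{1..n}. forces_rainbow n r)" using low by auto
    then show ?thesis using \<open>max_colors n = n\<close> unfolding sidon_rb_def by simp
  qed
qed

lemma sum_weight_prod_primes:
  assumes "finite I" "\<And>i. i \<in> I \<Longrightarrow> prime (p i)"
  shows "(\<Sum>q\<in>#prime_factorization (\<Prod>i\<in>I. p i). weight q) = (\<Sum>i\<in>I. weight (p i))"
  using assms
proof (induction I rule: finite_induct)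
  case (insert j I)
  have "p i \<noteq> 0" if "i \<in> insert j I" for i using insert.prems[OF that] by auto
  then show ?case using insert
    by (simp add: prime_factorization_mult prime_factorization_prime)
qed simp

theorem theorem1p2:
  fixes n k m f1 f2 :: nat and p :: "nat \<Rightarrow> nat"
  assumes "n \<ge> 2"
    and "n = (\<Prod>i\<in>{1..k}. p i)"
    and "\<And>i. i \<in> {1..k} \<Longrightarrow> prime (p i)"
    and "\<And>i j. i \<in> {1..k} \<Longrightarrow> j \<in> {1..k} \<Longrightarrow> i < j \<Longrightarrow> p i \<le> p j"
    and "m = (if \<exists>i\<in>{1..k}. p i \<ge> 3 then LEAST i. i \<in> {1..k} \<and> p i \<ge> 3 else k)"
    and "f1 = card {i \<in> {1..k}. i \<noteq> m \<and> p i \<le> 3}"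
    and "f2 = card {i \<in> {1..k}. i \<noteq> m \<and> p i \<ge> 5}"
  shows "sidon_rb n = sidon_rb (p m) + f1 + 2 * f2"
proof -
  have "k \<ge> 1" using assms(1,2) by (cases k) auto
  have large: "m \<in> {1..k} \<and> p m \<ge> 3 \<and> m \<le> i" if "i \<in> {1..k}" "p i \<ge> 3" for i
  proof -
    have m: "m = (LEAST i. i \<in> {1..k} \<and> p i \<ge> 3)" using assms(5) that by auto
    then show ?thesis using LeastI[of "\<lambda>i. i \<in> {1..k} \<and> p i \<ge> 3" i]
        Least_le[of "\<lambda>i. i \<in> {1..k} \<and> p i \<ge> 3" i] that by auto
  qed
  have m: "m \<in> {1..k}"
  proof (cases "\<exists>i\<in>{1..k}. p i \<ge> 3")
    case False
    then have "m = k" using assms(5) by (simp only: if_False)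
    then show ?thesis using \<open>k \<ge> 1\<close> by simp
  qed (use large in blast)
  \<comment> \<open>If some prime factor is at least 3, \<open>p m\<close> is the least of these by
    the ordering; otherwise all factors are 2.\<close>
  have three: "3 dvd n \<longleftrightarrow> p m = 3"
  proof
    assume "3 dvd n"
    then obtain i where i: "i \<in> {1..k}" "3 dvd p i"
      using prime_dvd_prod_iff[of "{1..k}" 3 p] assms(2) by auto
    then have "p i = 3" using three_dvd_prime assms(3) by blast
    then have "p m \<ge> 3" "m \<le> i" using large[OF i(1)] by auto
    moreover have "p m \<le> p i" using assms(4)[OF m i(1)] \<open>m \<le> i\<close> by (cases "m = i") auto
    ultimately show "p m = 3" using \<open>p i = 3\<close> by simp
  next
    assume "p m = 3"
    then show "3 dvd n" using assms(2) m dvd_prodI[of "{1..k}" m p] by simp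
  qed
  let ?J = "{1..k} - {m}"
  have w: "weight (p i) = (if p i \<le> 3 then 1 else 0) + 2 * (if p i \<ge> 5 then 1 else 0)"
    if "i \<in> ?J" for i
  proof -
    have "prime (p i)" using that assms(3) by blast
    \<comment> \<open>As 4 is not prime, \<open>f1\<close> and \<open>f2\<close> together count
      every index except \<open>m\<close>.\<close>
    then have "p i \<noteq> 4" by (auto simp: prime_nat_numeral_eq)
    then show ?thesis by (auto simp: weight_def)
  qed
  have "(\<Sum>i\<in>?J. weight (p i)) = (\<Sum>i\<in>?J. (if p i \<le> 3 then 1 else 0)) + 2 * (\<Sum>i\<in>?J. (if p i \<ge> 5 then 1 else 0))"
    unfolding sum_distrib_left sum.distrib[symmetric] using w by (intro sum.cong) auto
  also have "(\<Sum>i\<in>?J. (if p i \<le> 3 then 1 else 0)) = card {i\<in>?J. p i \<le> 3}"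
    by (simp add: sum.inter_filter[symmetric])
  also have "{i\<in>?J. p i \<le> 3} = {i \<in> {1..k}. i \<noteq> m \<and> p i \<le> 3}" by auto
  also have "(\<Sum>i\<in>?J. (if p i \<ge> 5 then 1 else 0)) = card {i\<in>?J. p i \<ge> 5}"
    by (simp add: sum.inter_filter[symmetric])
  also have "{i\<in>?J. p i \<ge> 5} = {i \<in> {1..k}. i \<noteq> m \<and> p i \<ge> 5}" by auto
  finally have J: "(\<Sum>i\<in>?J. weight (p i)) = f1 + 2 * f2" using assms(6,7) by simp
  have "(\<Sum>i\<in>{1..k}. weight (p i)) = weight (p m) + (f1 + 2 * f2)"
    using sum.remove[of "{1..k}" m "\<lambda>i. weight (p i)"] m J by simp
  \<comment> \<open>By \<open>three\<close>, the extra color for 3 is present on both sides or on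
    neither.\<close>
  then have "max_colors n = max_colors (p m) + f1 + 2 * f2"
    using sum_weight_prod_primes[of "{1..k}" p] assms(2,3) three max_colors_prime[OF assms(3)[OF m]]
    by (simp add: max_colors_def)
  then show ?thesis using sidon_rb_eq[of n] sidon_rb_eq[of "p m"] assms(1) assms(3)[OF m]
    by (simp add: prime_gt_0_nat)
qed

end
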